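(* Let $\alpha\in\mathcal{DP}_n$ be such that $h(\alpha)=p$. Then $f(\alpha)=0$ or $f(\alpha)=1$ or $f(\alpha)=p$.
   Context: For $n\ge 0$ let $X_n=\{1,2,\dots,n\}$ and let $\mathcal{I}_n$ be the set of all partial injective maps of $X_n$ (including the empty map). $\mathcal{DP}_n$ is the set of all $\alpha\in\mathcal{I}_n$ with $|x-y|=|x\alpha-y\alpha|$ for all $x,y\in\mathrm{Dom}\,\alpha$ (partial isometries; $x\alpha$ denotes the image of $x$ under $\alpha$). The height of $\alpha$ is $h(\alpha)=|\mathrm{Im}\,\alpha|$, and $f(\alpha)=|F(\alpha)|$ where $F(\alpha)=\{x\in\mathrm{Dom}\,\alpha: x\alpha=x\}$. *)

theory Defs
  imports Main
begin

text \<open>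
  A partial map is a library map \<open>nat \<rightharpoonup> nat\<close>; for \<open>x \<in> dom \<alpha>\<close> the image of \<open>x\<close>
  under \<open>\<alpha>\<close> is \<open>the (\<alpha> x)\<close>.
\<close>

definition X :: "nat \<Rightarrow> nat set" where
  "X n = {1..n}"

definition partial_injections :: "nat \<Rightarrow> (nat \<rightharpoonup> nat) set" where
  "partial_injections n = {\<alpha>. dom \<alpha> \<subseteq> X n \<and> ran \<alpha> \<subseteq> X n \<and> inj_on \<alpha> (dom \<alpha>)}"

text \<open>Distances are taken in \<^typ>\<open>int\<close>, since subtraction on \<^typ>\<open>nat\<close> truncates.\<close>

definition partial_isometries :: "nat \<Rightarrow> (nat \<rightharpoonup> nat) set" where
  "partial_isometries n = {\<alpha> \<in> partial_injections n.
     \<forall>x \<in> dom \<alpha>. \<forall>y \<in> dom \<alpha>.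
       \<bar>int x - int y\<bar> = \<bar>int (the (\<alpha> x)) - int (the (\<alpha> y))\<bar>}"

definition height :: "(nat \<rightharpoonup> nat) \<Rightarrow> nat" where
  "height \<alpha> = card (ran \<alpha>)"

definition fixed_points :: "(nat \<rightharpoonup> nat) \<Rightarrow> nat set" where
  "fixed_points \<alpha> = {x \<in> dom \<alpha>. the (\<alpha> x) = x}"

definition num_fixed :: "(nat \<rightharpoonup> nat) \<Rightarrow> nat" where
  "num_fixed \<alpha> = card (fixed_points \<alpha>)"

end

theory Submission
  imports Defs
begin

text \<open>A point of a line is determined by its distances to two distinct points
  (\<open>int_eq_if_equidistant_from_two\<close>). If \<alpha> fixes distinct a and b, every x in
  its domain and the image of x are equally far from a and equally far from b, hence equal. So two
  fixed points already make \<alpha> a partial identity, whose fixed points fill its range.\<close>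

text \<open>If x and y differed, each equation would make its centre the midpoint of x and y,
  forcing a = b.\<close>

lemma int_eq_if_equidistant_from_two:
  fixes a b x y :: int
  assumes "a \<noteq> b" "\<bar>x - a\<bar> = \<bar>y - a\<bar>" "\<bar>x - b\<bar> = \<bar>y - b\<bar>"
  shows "x = y"
  using assms by linarith

theorem lemma1p2:
  fixes n p :: nat and \<alpha> :: "nat \<rightharpoonup> nat"
  assumes "\<alpha> \<in> partial_isometries n"
    and "height \<alpha> = p"
  shows "num_fixed \<alpha> = 0 \<or> num_fixed \<alpha> = 1 \<or> num_fixed \<alpha> = p"
proof (cases "card (fixed_points \<alpha>) \<le> 1")
  case True
  then show ?thesis by (auto simp: num_fixed_def)
next
  case False
  \<comment> \<open>\<open>card\<close> is 0 on infinite sets, so a cardinality above 1 gives the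
    finiteness that \<open>card_le_Suc0_iff_eq\<close> requires.\<close>
  then have "finite (fixed_points \<alpha>)"
    using card.infinite by fastforce
  with False obtain a b where ab: "a \<in> fixed_points \<alpha>" "b \<in> fixed_points \<alpha>" "a \<noteq> b"
    using card_le_Suc0_iff_eq[of "fixed_points \<alpha>"] by auto
  have fixed: "the (\<alpha> x) = x" if "x \<in> dom \<alpha>" for x
  proof -
    \<comment> \<open>Since c is its own image, the isometry condition for x and c measures both
      distances from the same point.\<close>
    have dist_fixed: "\<bar>int x - int c\<bar> = \<bar>int (the (\<alpha> x)) - int c\<bar>" if "c \<in> fixed_points \<alpha>" for c
    proof -
      have "c \<in> dom \<alpha>" "the (\<alpha> c) = c"
        using that by (auto simp: fixed_points_def)
      moreover have "\<bar>int x - int c\<bar> = \<bar>int (the (\<alpha> x)) - int (the (\<alpha> c))\<bar>"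
        using assms(1) \<open>x \<in> dom \<alpha>\<close> \<open>c \<in> dom \<alpha>\<close>
        unfolding partial_isometries_def by blast
      ultimately show ?thesis by simp
    qed
    have "int x = int (the (\<alpha> x))"
      by (rule int_eq_if_equidistant_from_two[OF _ dist_fixed[OF ab(1)] dist_fixed[OF ab(2)]])
        (simp add: ab(3))
    then show ?thesis by simp
  qed
  then have "fixed_points \<alpha> = dom \<alpha>"
    by (auto simp: fixed_points_def)
  \<comment> \<open>\<open>height\<close> counts the range, so the domain has to be traded for
    it.\<close>
  moreover have "ran \<alpha> = dom \<alpha>"
    using fixed by (force simp: ran_def dom_def)
  ultimately show ?thesis
    using assms(2) by (simp add: num_fixed_def height_def)
qed

end
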